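(* Every modular spatial lattice is strongly spatial.
   Context: A point (completely join-irreducible element) of a lattice $L$ is an element $p$ such that the set $\{x\in L\mid x<p\}$ has a largest element; $\mathrm{J}_{\mathrm c}(L)$ denotes the set of points of $L$. A subset $\Sigma$ of $L$ is join-dense if every element of $L$ is a (possibly infinite or empty) join of elements of $\Sigma$. $L$ is spatial if $\mathrm{J}_{\mathrm c}(L)$ is join-dense in $L$ (no completeness is assumed). A subset $X$ refines a subset $Y$ if every element of $X$ is below some element of $Y$. A finite subset $E\subseteq L$ is a join-cover of $p$ if $p\le\bigvee E$ ($\bigvee\varnothing$ is the least element if it exists; otherwise $\varnothing$ covers nothing); it is a minimal join-cover of $p$ if moreover, for every join-cover $X$ of $p$ refining $E$, one has $E\subseteq X$. $L$ is strongly spatial if $\mathrm{J}_{\mathrm c}(L)$ is join-dense in $L$ and for every point $p$ of $L$ and every join-cover $X$ of $p$, there is a minimal join-cover $I$ of $p$ with $I\subseteq\mathrm{J}_{\mathrm c}(L)$ and $I$ refining $X$. *)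

theory Defs
  imports "HOL-Library.Lub_Glb"
begin

text \<open>
  A lattice is a type of class \<^class>\<open>lattice\<close>; neither bounds nor completeness are assumed.
  Accordingly, joins of possibly infinite or empty sets are expressed relationally:
  \<^term>\<open>isLub UNIV S x\<close> says that the join of \<open>S\<close> exists and equals \<open>x\<close>. For \<open>S = {}\<close>
  it says that \<open>x\<close> is the least element.
\<close>

definition modular_lattice :: "'a::lattice itself \<Rightarrow> bool"
  where "modular_lattice _ \<longleftrightarrow>
    (\<forall>x y z :: 'a. x \<le> z \<longrightarrow> sup x (inf y z) = inf (sup x y) z)"

definition points :: "'a::lattice set"
  where "points = {p. \<exists>m. m < p \<and> (\<forall>x. x < p \<longrightarrow> x \<le> m)}"

definition join_dense :: "'a::lattice set \<Rightarrow> bool"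
  where "join_dense \<Sigma> \<longleftrightarrow> (\<forall>x. \<exists>S \<subseteq> \<Sigma>. isLub UNIV S x)"

definition spatial :: "'a::lattice itself \<Rightarrow> bool"
  where "spatial _ \<longleftrightarrow> join_dense (points :: 'a set)"

definition refines :: "'a::lattice set \<Rightarrow> 'a set \<Rightarrow> bool"
  where "refines X Y \<longleftrightarrow> (\<forall>x\<in>X. \<exists>y\<in>Y. x \<le> y)"

text \<open>
  In a lattice without least element no \<open>s\<close> below exists for \<^prop>\<open>E = {}\<close>,
  so the empty set covers nothing there.
\<close>

definition join_cover :: "'a::lattice \<Rightarrow> 'a set \<Rightarrow> bool"
  where "join_cover p E \<longleftrightarrow> finite E \<and> (\<exists>s. isLub UNIV E s \<and> p \<le> s)"

definition minimal_join_cover :: "'a::lattice \<Rightarrow> 'a set \<Rightarrow> bool"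
  where "minimal_join_cover p E \<longleftrightarrow>
    join_cover p E \<and> (\<forall>X. join_cover p X \<and> refines X E \<longrightarrow> E \<subseteq> X)"

definition strongly_spatial :: "'a::lattice itself \<Rightarrow> bool"
  where "strongly_spatial _ \<longleftrightarrow>
    join_dense (points :: 'a set) \<and>
    (\<forall>p \<in> (points :: 'a set). \<forall>X. join_cover p X \<longrightarrow>
      (\<exists>I. minimal_join_cover p I \<and> I \<subseteq> points \<and> refines I X))"

end

theory Submission
  imports Defs
begin

text \<open>
  Let \<open>p\<close> be a point with lower cover \<open>m\<close>, and let \<open>p \<le> a \<squnion> b\<close> with \<open>\<not> p \<le> b\<close>. Modularity
  transposes the quotient \<open>p/m\<close> up to \<open>(p \<squnion> b)/(m \<squnion> b)\<close> and then down to
  \<open>(a \<sqinter> (p \<squnion> b))/(a \<sqinter> (m \<squnion> b))\<close>, so that the latter is again a proper quotient. By spatiality a point \<open>q\<close>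
  lies below its upper end but not below its lower end, and then \<open>q \<le> a\<close>, \<open>p \<le> q \<squnion> b\<close> and
  \<open>\<not> p \<le> l \<squnion> b\<close> for the lower cover \<open>l\<close> of \<open>q\<close>.

  Given a finite join-cover of \<open>p\<close>, its elements are discarded when redundant and otherwise replaced
  by such points, one at a time; each step preserves what was achieved before, because it only
  shrinks the remaining elements. A cover in which no point can be replaced by its lower
  cover is minimal.
\<close>

definition lower_cover :: "'a::lattice \<Rightarrow> 'a \<Rightarrow> bool"
  where "lower_cover m p \<longleftrightarrow> m < p \<and> (\<forall>x. x < p \<longrightarrow> x \<le> m)"

text \<open>
  Join-covering without reference to the join. For \<open>X = {}\<close> it says that \<open>p\<close> is the
  least element, so that the empty set needs no separate treatment in lattices without least element.
\<close>

definition covers :: "'a::lattice set \<Rightarrow> 'a \<Rightarrow> bool"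
  where "covers X p \<longleftrightarrow> (\<forall>u. (\<forall>x\<in>X. x \<le> u) \<longrightarrow> p \<le> u)"

text \<open>This form makes \<open>y\<close> a point and survives any shrinking of the other
  elements of \<open>X\<close>.\<close>

definition tight :: "'a::lattice \<Rightarrow> 'a set \<Rightarrow> 'a \<Rightarrow> bool"
  where "tight p X y \<longleftrightarrow> (\<exists>l. lower_cover l y \<and> \<not> covers (insert l (X - {y})) p)"

lemma points_iff: "p \<in> points \<longleftrightarrow> (\<exists>m. lower_cover m p)"
  by (simp add: points_def lower_cover_def)

lemma covers_refines:
  assumes "refines X Y" "covers X p"
  shows "covers Y p"
  using assms unfolding refines_def covers_def by (meson order_trans)

lemma refines_trans: "refines X Y \<Longrightarrow> refines Y Z \<Longrightarrow> refines X Z"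
  unfolding refines_def by (meson order_trans)

lemma covers_Sup_fin:
  assumes "finite X" "X \<noteq> {}"
  shows "covers X p \<longleftrightarrow> p \<le> Sup_fin X"
  unfolding covers_def Sup_fin.bounded_iff[OF assms, symmetric]
  by (meson order_refl order_trans)

lemma isLub_UNIV_iff:
  "isLub UNIV S x \<longleftrightarrow> (\<forall>y\<in>S. y \<le> x) \<and> (\<forall>u. (\<forall>y\<in>S. y \<le> u) \<longrightarrow> x \<le> u)"
  by (simp add: isLub_def leastP_def setge_def isUb_def setle_def Ball_def)

lemma join_cover_imp_covers: "join_cover p X \<Longrightarrow> covers X p"
  unfolding join_cover_def covers_def isLub_UNIV_iff by (meson order_trans)

lemma not_covers_empty:
  assumes "lower_cover m p"
  shows "\<not> covers {} p"
  using assms unfolding lower_cover_def covers_def by (auto simp: less_le_not_le)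

lemma covers_imp_join_cover:
  assumes "finite X" "lower_cover m p" "covers X p"
  shows "join_cover p X"
proof -
  have "X \<noteq> {}"
    using assms not_covers_empty by blast
  have "isLub UNIV X (Sup_fin X)"
    unfolding isLub_UNIV_iff
    using assms(1) \<open>X \<noteq> {}\<close> by (simp add: Sup_fin.coboundedI Sup_fin.boundedI)
  moreover have "p \<le> Sup_fin X"
    using assms \<open>X \<noteq> {}\<close> covers_Sup_fin by blast
  ultimately show ?thesis
    using assms(1) by (auto simp: join_cover_def)
qed

lemma spatial_separation:
  assumes "spatial TYPE('a::lattice)" "\<not> x \<le> (c::'a)"
  obtains q l where "lower_cover l q" "q \<le> x" "\<not> q \<le> c"
proof -
  obtain S where S: "S \<subseteq> points" "isLub UNIV S x"
    using assms(1) unfolding spatial_def join_dense_def by blast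
  then obtain q where "q \<in> S" "\<not> q \<le> c" "q \<le> x"
    using assms(2) unfolding isLub_UNIV_iff by blast
  then show thesis
    using that S(1) points_iff by blast
qed

lemma point_replacement:
  fixes a b p :: "'a::lattice"
  assumes "modular_lattice TYPE('a)" "spatial TYPE('a)"
    and m: "lower_cover m p" and pab: "p \<le> sup a b" and pb: "\<not> p \<le> b"
  obtains q l where "lower_cover l q" "q \<le> a" "p \<le> sup q b" "\<not> p \<le> sup l b"
proof -
  have modular: "sup x (inf y z) = inf (sup x y) z" if "x \<le> z" for x y z :: 'a
    using assms(1) that unfolding modular_lattice_def by blast
  have below: "inf x y \<le> k" if "lower_cover k x" "\<not> x \<le> y" for x y k :: 'a
  proof -
    have "inf x y \<noteq> x"
      using that(2) by (simp add: le_iff_inf)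
    then have "inf x y < x"
      by (simp add: less_le)
    then show ?thesis
      using that(1) by (simp add: lower_cover_def)
  qed
  \<comment> \<open>The upward transposition stays proper. It is needed twice: for \<open>p\<close>
    over \<open>m\<close> and, at the end, for \<open>q\<close> over \<open>l\<close>.\<close>
  have strict: "\<not> x \<le> sup k b" if k: "lower_cover k x" and "\<not> x \<le> b" for x k
  proof
    assume "x \<le> sup k b"
    then have "x = inf (sup k b) x"
      by (simp only: inf_absorb2)
    also have "\<dots> = sup k (inf b x)"
      using k by (intro modular[symmetric]) (simp add: lower_cover_def less_imp_le)
    also have "\<dots> \<le> k"
      using below[OF that] by (simp add: inf_commute)
    finally show False
      using k by (simp add: lower_cover_def less_le_not_le)
  qed
  \<comment> \<open>Otherwise \<open>p\<close> meets \<open>sup x b\<close> below \<open>m\<close>;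
    joining \<open>b\<close> to this meet gives, by modularity, an element above \<open>x\<close>,
    so \<open>x \<le> sup m b\<close>.\<close>
  have generate: "p \<le> sup x b" if "x \<le> sup p b" "\<not> x \<le> sup m b" for x
  proof (rule ccontr)
    assume "\<not> p \<le> sup x b"
    then have "inf p (sup x b) \<le> m"
      using below m by blast
    moreover have "sup b (inf p (sup x b)) = inf (sup b p) (sup x b)"
      by (rule modular) simp
    moreover have "x \<le> inf (sup b p) (sup x b)"
      using that by (simp add: sup_commute)
    moreover have "sup b (inf p (sup x b)) \<le> sup m b"
      using calculation(1) by (simp add: le_supI1)
    ultimately show False
      using that(2) by (metis order_trans)
  qed
  \<comment> \<open>The downward transposition stays proper: joining \<open>b\<close> to the upper
    end gives an element above \<open>p\<close>.\<close>
  have "\<not> inf a (sup p b) \<le> inf a (sup m b)"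
  proof
    assume "inf a (sup p b) \<le> inf a (sup m b)"
    then have "inf a (sup p b) \<le> sup m b"
      by (simp only: le_inf_iff)
    then have "sup b (inf a (sup p b)) \<le> sup m b"
      by (simp only: le_sup_iff sup_ge2 simp_thms)
    moreover have "sup b (inf a (sup p b)) = inf (sup b a) (sup p b)"
      by (rule modular) simp
    moreover have "p \<le> inf (sup b a) (sup p b)"
      using pab by (simp add: sup_commute)
    ultimately show False
      using strict[OF m pb] by (metis order_trans)
  qed
  then obtain q l where l: "lower_cover l q" and q: "q \<le> inf a (sup p b)"
      and "\<not> q \<le> inf a (sup m b)"
    using spatial_separation[OF assms(2)] by blast
  then have qm: "\<not> q \<le> sup m b"
    by simp
  then have "\<not> q \<le> b"
    by (meson order_trans sup_ge2)
  \<comment> \<open>Since \<open>q \<le> sup p b\<close>, covering \<open>p\<close> by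
    \<open>l\<close> and \<open>b\<close> would also cover \<open>q\<close>.\<close>
  have "\<not> p \<le> sup l b"
  proof
    assume "p \<le> sup l b"
    then have "sup p b \<le> sup l b"
      by simp
    then have "q \<le> sup l b"
      using q by (meson le_inf_iff order_trans)
    then show False
      using strict[OF l \<open>\<not> q \<le> b\<close>] by blast
  qed
  moreover have "p \<le> sup q b"
    using generate qm q by simp
  ultimately show thesis
    using that l q by simp
qed

lemma point_replacement_cover:
  fixes p x :: "'a::lattice"
  assumes "modular_lattice TYPE('a)" "spatial TYPE('a)"
    and m: "lower_cover m p" and "finite B" "covers (insert x B) p" "\<not> covers B p"
  obtains q l where "lower_cover l q" "q \<le> x" "covers (insert q B) p" "\<not> covers (insert l B) p"
proof (cases "B = {}")
  case True
  \<comment> \<open>The empty set may have no join to serve as \<open>b\<close>; here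
    \<open>p\<close> and \<open>m\<close> themselves serve as \<open>q\<close> and
    \<open>l\<close>.\<close>
  then have "p \<le> x" "covers (insert p B) p" "\<not> covers (insert m B) p"
    using assms by (auto simp: covers_def lower_cover_def less_le_not_le)
  then show thesis
    using that m by blast
next
  case False
  have insert_iff: "covers (insert y B) p \<longleftrightarrow> p \<le> sup y (Sup_fin B)" for y
    using False \<open>finite B\<close> covers_Sup_fin[of "insert y B"] by simp
  have "\<not> p \<le> Sup_fin B"
    using False assms covers_Sup_fin by blast
  with assms show thesis
    using point_replacement[OF assms(1,2) m] that unfolding insert_iff by metis
qed

text \<open>Induction on the number of elements that are not tight.\<close>

lemma tight_refinement:
  fixes p :: "'a::lattice"
  assumes "modular_lattice TYPE('a)" "spatial TYPE('a)" and m: "lower_cover m p"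
  shows "finite X \<Longrightarrow> covers X p \<Longrightarrow>
    \<exists>I. finite I \<and> covers I p \<and> refines I X \<and> (\<forall>y\<in>I. tight p I y)"
proof (induction "card {y \<in> X. \<not> tight p X y}" arbitrary: X rule: less_induct)
  case less
  show ?case
  proof (cases "\<forall>y\<in>X. tight p X y")
    case True
    then show ?thesis
      using less.prems by (auto simp: refines_def)
  next
    case False
    then obtain x where x: "x \<in> X" "\<not> tight p X x"
      by blast
    define B where "B = X - {x}"
    have B: "finite B" "insert x B = X" "x \<notin> B"
      using x less.prems by (auto simp: B_def)
    have step: ?thesis
      if Y: "finite Y" "covers Y p" "refines Y X"
        and sub: "{y \<in> Y. \<not> tight p Y y} \<subseteq> {y \<in> X. \<not> tight p X y} - {x}" for Y
    proof -
      have "card {y \<in> Y. \<not> tight p Y y} < card {y \<in> X. \<not> tight p X y}"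
        using sub x less.prems(1) by (intro psubset_card_mono) auto
      then show ?thesis
        using less.hyps Y refines_trans by blast
    qed
    have tight_mono: "tight p Y y" if "tight p X y" "refines (Y - {y}) (X - {y})" for Y y
    proof -
      have "refines (insert l (Y - {y})) (insert l (X - {y}))" for l
        using that(2) by (auto simp: refines_def)
      then show ?thesis
        using that(1) covers_refines unfolding tight_def by blast
    qed
    show ?thesis
    proof (cases "covers B p")
      case True
      have "tight p B y" if "tight p X y" for y
        using that by (rule tight_mono) (auto simp: B_def refines_def)
      then show ?thesis
        using B True by (intro step[of B]) (auto simp: refines_def)
    next
      case False
      then obtain q l where q: "lower_cover l q" "q \<le> x" "covers (insert q B) p"
          "\<not> covers (insert l B) p"
        using point_replacement_cover[OF assms \<open>finite B\<close>] B less.prems by metis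
      \<comment> \<open>This ensures that removing \<open>q\<close> from \<open>insert q B\<close>
        leaves exactly \<open>B\<close>, as tightness of \<open>q\<close> requires.\<close>
      have "q \<notin> B"
        using False q(3) by (auto simp: insert_absorb)
      then have "tight p (insert q B) q"
        using q by (auto simp: tight_def)
      moreover have "tight p (insert q B) y" if "y \<in> B" "tight p X y" for y
        using that(2)
      proof (rule tight_mono)
        show "refines (insert q B - {y}) (X - {y})"
          using that B q(2) unfolding refines_def by auto
      qed
      moreover have "refines (insert q B) X"
        using B q(2) unfolding refines_def by auto
      ultimately show ?thesis
        using B q by (intro step[of "insert q B"]) auto
    qed
  qed
qed

text \<open>If a cover \<open>X\<close> refining \<open>I\<close> misses \<open>y\<close>, its
  elements below \<open>y\<close> are strictly below \<open>y\<close>, hence below the lower cover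
  \<open>l\<close>. So \<open>l\<close> could replace \<open>y\<close> in \<open>I\<close>, against
  tightness.\<close>

lemma tight_imp_minimal:
  assumes "join_cover p I" "\<forall>y\<in>I. tight p I y"
  shows "minimal_join_cover p I"
  unfolding minimal_join_cover_def
proof (intro conjI allI impI subsetI)
  fix X y
  assume X: "join_cover p X \<and> refines X I" and "y \<in> I"
  then obtain l where l: "lower_cover l y" "\<not> covers (insert l (I - {y})) p"
    using assms(2) by (auto simp: tight_def)
  show "y \<in> X"
  proof (rule ccontr)
    assume "y \<notin> X"
    then have "refines X (insert l (I - {y}))"
      using X l(1) unfolding refines_def lower_cover_def
      by (metis Diff_iff insertCI insertE empty_iff order.not_eq_order_implies_strict)
    then show False
      using X l(2) covers_refines join_cover_imp_covers by blast
  qed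
qed (fact assms(1))

theorem theorem7p4:
  assumes "modular_lattice TYPE('a::lattice)"
    and "spatial TYPE('a)"
  shows "strongly_spatial TYPE('a)"
  unfolding strongly_spatial_def
proof (intro conjI ballI allI impI)
  show "join_dense (points :: 'a set)"
    using assms(2) by (simp add: spatial_def)
next
  fix p :: 'a and X
  assume "p \<in> points" and X: "join_cover p X"
  then obtain m where m: "lower_cover m p"
    by (auto simp: points_iff)
  obtain I where I: "finite I" "covers I p" "refines I X" "\<forall>y\<in>I. tight p I y"
    using tight_refinement[OF assms m] X join_cover_imp_covers unfolding join_cover_def by metis
  have "minimal_join_cover p I"
    using I m covers_imp_join_cover tight_imp_minimal by blast
  moreover have "I \<subseteq> points"
    using I(4) unfolding tight_def points_iff subset_iff by blast
  ultimately show "\<exists>I. minimal_join_cover p I \<and> I \<subseteq> points \<and> refines I X"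
    using I(3) by blast
qed

end
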